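(* For every positive integer $N$, \[ \sum_{\substack{\pi\in\mathcal{P}_{3,4}\\ |\pi|=N}} (-1)^{\nu(\pi)} \;-\; \sum_{\substack{\pi\in\mathcal{P}_{2,4}\\ |\pi|=N}} (-1)^{\nu(\pi)} \;=\; (-1)^N \chi(N \text{ is not a perfect square}). \]
   Context: A partition is a finite non-increasing sequence of positive integers (its parts); $|\pi|$ is the sum of its parts and $\nu(\pi)$ the number of parts counted with multiplicity. For $r\in\{2,3\}$, $\mathcal{P}_{r,4}$ is the set of non-empty partitions in which every even part size occurs at most once (odd parts may repeat) and whose smallest part is congruent to $r$ modulo $4$. $\chi(S)$ is $1$ if the statement $S$ is true and $0$ otherwise. *)

theory Defs
  imports Main "HOL-Computational_Algebra.Nth_Powers"
begin

definition is_partition :: "nat list \<Rightarrow> bool" where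
  "is_partition \<pi> \<longleftrightarrow> sorted_wrt (\<ge>) \<pi> \<and> (\<forall>p\<in>set \<pi>. 0 < p)"

(* The size and the number of parts of a partition are sum_list and length. The parameter r is
   meant to be a residue, i.e. r < 4. *)
definition partitions4 :: "nat \<Rightarrow> nat list set" where
  "partitions4 r = {\<pi>. is_partition \<pi> \<and> \<pi> \<noteq> [] \<and>
     (\<forall>p. even p \<longrightarrow> count_list \<pi> p \<le> 1) \<and> Min (set \<pi>) mod 4 = r}"

(* So the sums over partitions of a fixed N are never sums over infinite sets. *)
lemma finite_partitions4_of: "finite {\<pi> \<in> partitions4 r. sum_list \<pi> = N}"
proof (rule finite_subset)
  have len: "length xs \<le> sum_list xs" if "\<forall>p\<in>set xs. 0 < p" for xs :: "nat list"
    using that by (induction xs) auto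
  show "{\<pi> \<in> partitions4 r. sum_list \<pi> = N} \<subseteq> {xs. set xs \<subseteq> {..N} \<and> length xs \<le> N}"
    using len member_le_sum_list by (fastforce simp: partitions4_def is_partition_def)
  show "finite {xs. set xs \<subseteq> {..N} \<and> length xs \<le> N}"
    by (rule finite_lists_length_le) simp
qed

end

(* Let P_s be the product of (1 - q^(2k)) / (1 + q^(2k-1)) over k > s. Splitting off the smallest part
   of a partition, the difference of the two generating functions is (1 - q) times the sum of
   q^(2s) P_s over odd s, that is, half the difference of (1 - q) H(q^2) and (1 - q) H(-q^2), where
   H(z) is the sum of z^s P_s over all s. The series H(q^2) telescopes to 1 / (1 + q). The recurrence
   of P_s gives (1 - z) H(z) = (1 + z q) H(z q^2); iterating it turns (1 - q) H(-q^2) into the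
   product of (1 - q^k) / (1 + q^k), which is the theta series 1 + 2 sum (-1)^j q^(j^2) by Gauss. *)

theory Submission
  imports Defs "HOL-Computational_Algebra.Formal_Power_Series"
begin

unbundle fps_syntax

subsection \<open>Truncated equality of power series\<close>

text \<open>Congruence modulo \<open>fps_X ^ M\<close>. Finite sums and products can then stand for
  the infinite ones, and no limit of power series is taken.\<close>

definition fps_eq_upto :: "nat \<Rightarrow> 'a::comm_ring_1 fps \<Rightarrow> 'a fps \<Rightarrow> bool" where
  "fps_eq_upto M f g \<longleftrightarrow> (\<forall>i<M. f $ i = g $ i)"

lemma fps_eq_upto_refl [simp]: "fps_eq_upto M f f"
  by (simp add: fps_eq_upto_def)

lemma fps_eq_upto_sym: "fps_eq_upto M f g \<Longrightarrow> fps_eq_upto M g f"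
  by (simp add: fps_eq_upto_def)

lemma fps_eq_upto_trans [trans]: "fps_eq_upto M f g \<Longrightarrow> fps_eq_upto M g h \<Longrightarrow> fps_eq_upto M f h"
  by (simp add: fps_eq_upto_def)

lemma fps_eq_upto_diff:
  "fps_eq_upto M f g \<Longrightarrow> fps_eq_upto M f' g' \<Longrightarrow> fps_eq_upto M (f - f') (g - g')"
  by (simp add: fps_eq_upto_def)

lemma fps_eq_upto_mult:
  "fps_eq_upto M f g \<Longrightarrow> fps_eq_upto M f' g' \<Longrightarrow> fps_eq_upto M (f * f') (g * g')"
  by (simp add: fps_eq_upto_def fps_mult_nth)

lemma fps_eq_upto_sum:
  "(\<And>s. s \<in> S \<Longrightarrow> fps_eq_upto M (f s) (g s)) \<Longrightarrow> fps_eq_upto M (sum f S) (sum g S)"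
  by (simp add: fps_eq_upto_def fps_sum_nth)

lemma fps_eq_upto_X_power_mult:
  assumes "M \<le> k"
  shows "fps_eq_upto M (fps_X ^ k * f) 0"
  using assms by (simp add: fps_eq_upto_def fps_X_power_mult_nth)

lemma one_plus_X_power_upto: "fps_eq_upto M (1 + fps_X ^ M) 1"
  and one_minus_X_power_upto: "fps_eq_upto M (1 - fps_X ^ M) 1"
  by (simp_all add: fps_eq_upto_def)

text \<open>Coefficient \<open>i\<close> of \<open>u * f\<close> is \<open>f $ i\<close> plus a
  combination of lower coefficients of \<open>f\<close>, which strong induction has already settled.
  This serves as division by a product with constant term 1.\<close>

lemma fps_eq_upto_mult_cancel:
  assumes u: "u $ 0 = 1" and eq: "fps_eq_upto M (u * f) (u * g)"
  shows "fps_eq_upto M f g"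
  unfolding fps_eq_upto_def
proof (intro allI impI)
  fix i assume "i < M"
  then show "f $ i = g $ i"
  proof (induction i rule: less_induct)
    case (less i)
    have "f $ (i - j) = g $ (i - j)" if "j \<in> {0<..i}" for j
      using that less by auto
    then have "(\<Sum>j\<in>{0<..i}. u $ j * f $ (i - j)) = (\<Sum>j\<in>{0<..i}. u $ j * g $ (i - j))"
      by simp
    moreover have "(u * f) $ i = (u * g) $ i"
      using eq less.prems by (simp add: fps_eq_upto_def)
    ultimately show ?case
      by (simp add: fps_mult_nth sum.head u)
  qed
qed

subsection \<open>A finite form of Gauss's theta identity\<close>

text \<open>Shanks' method, with denominators cleared: the step from \<open>n\<close> to \<open>n + 1\<close> telescopes.\<close>

lemma gauss_theta_finite:
  fixes x :: "'a::comm_ring_1"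
  shows "(1 + 2 * (\<Sum>j=1..n. (-1) ^ j * x ^ (j ^ 2))) * (\<Prod>k=1..n. 1 + x ^ k)
    = (\<Prod>k=1..n. 1 - x ^ k)
      + 2 * (\<Sum>s=1..n. (-1) ^ s * x ^ (s * (n + 1)) * (\<Prod>k\<in>{s<..n}. 1 - x ^ k)
                          * (\<Prod>k\<in>{1..<s}. 1 + x ^ k))"
proof (induction n)
  case 0
  show ?case by simp
next
  case (Suc n)
  let ?m = "Suc n"
  define A where "A s = (\<Prod>k\<in>{s<..n}. 1 - x ^ k)" for s
  define B where "B s = (\<Prod>k\<in>{1..<Suc s}. 1 + x ^ k)" for s
  \<comment> \<open>\<open>g\<close> is the telescoping certificate. With \<open>t s\<close> the
    summand for \<open>n\<close>, the summand for \<open>?m\<close> is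
    \<open>(1 + x ^ ?m) * t s\<close> plus \<open>g (s - 1) - g s\<close>; the factor
    \<open>1 + x ^ ?m\<close> is the one that the product on the left gains.\<close>
  define g where "g s = (-1) ^ s * x ^ (Suc s * ?m) * A s * B s" for s
  define t where "t s = (-1) ^ s * x ^ (s * ?m) * A s * (\<Prod>k\<in>{1..<s}. 1 + x ^ k)" for s
  have A_step: "A s = (1 - x ^ Suc s) * A (Suc s)" if "s < n" for s
  proof -
    have "{s<..n} = insert (Suc s) {Suc s<..n}" using that by auto
    then show ?thesis by (simp add: A_def)
  qed
  have B_step: "B (Suc s) = (1 + x ^ Suc s) * B s" for s
    by (simp add: B_def mult.commute)
  have term_diff: "x ^ s * (1 - x ^ ?m) * t s - (1 + x ^ ?m) * t s = g (s - 1) - g s"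
    if s: "s \<in> {1..n}" for s
  proof -
    obtain r where r: "s = Suc r" "r < n" using s by (cases s) auto
    define u where "u = (-1) ^ r * x ^ (Suc r * ?m) * A (Suc r) * B r"
    have "t s = - u"
      by (simp add: t_def u_def B_def r)
    moreover have "g r = (1 - x ^ s) * u"
      using r(2) by (simp only: g_def u_def A_step r(1) mult_ac)
    moreover have "g s = - (x ^ ?m * (1 + x ^ s) * u)"
    proof -
      have "x ^ (Suc (Suc r) * ?m) = x ^ (Suc r * ?m) * x ^ ?m"
        by (simp add: power_add mult_ac)
      then show ?thesis
        unfolding g_def u_def r(1) B_step by (simp del: mult_Suc power_Suc add: power_Suc[of "-1"] mult_ac)
    qed
    moreover have "s - 1 = r" using r(1) by simp
    ultimately show ?thesis by (simp only:) (simp add: algebra_simps)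
  qed
  have telescope: "(\<Sum>s=1..n. g (s - 1) - g s) = g 0 - g n"
    by (induction n) auto
  have prod_Suc: "(\<Prod>k\<in>{s<..?m}. 1 - x ^ k) = A s * (1 - x ^ ?m)" if "s \<le> n" for s
  proof -
    have "{s<..?m} = insert ?m {s<..n}" using that by auto
    then show ?thesis by (simp add: A_def mult.commute)
  qed
  have A0: "(\<Prod>k=1..n. 1 - x ^ k) = A 0"
    unfolding A_def by (rule prod.cong) auto
  have Bn: "(\<Prod>k=1..n. 1 + x ^ k) = B n"
    unfolding B_def by (rule prod.cong) auto
  have IH: "(1 + 2 * (\<Sum>j=1..n. (-1) ^ j * x ^ (j ^ 2))) * B n = A 0 + 2 * (\<Sum>s=1..n. t s)"
    using Suc.IH unfolding A0 Bn by (simp add: t_def A_def)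
  define w where "w s = (-1) ^ s * x ^ (s * (?m + 1)) * (\<Prod>k\<in>{s<..?m}. 1 - x ^ k)
                          * (\<Prod>k\<in>{1..<s}. 1 + x ^ k)" for s
  have w_less: "w s = (1 + x ^ ?m) * t s + (g (s - 1) - g s)" if s: "s \<in> {1..n}" for s
  proof -
    have "x ^ (s * (?m + 1)) = x ^ s * x ^ (s * ?m)"
      by (simp add: power_add mult_ac)
    then have "w s = x ^ s * (1 - x ^ ?m) * t s"
      using s unfolding w_def t_def by (simp only: prod_Suc atLeastAtMost_iff mult_ac)
    then show ?thesis
      using term_diff[OF s] by (simp only: diff_eq_eq add.commute)
  qed
  have w_last: "w ?m = (-1) ^ ?m * x ^ (?m * ?m) * x ^ ?m * B n"
    unfolding w_def B_def by (simp only: add_mult_distrib2 power_add mult_1_right mult.assoc) simp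
  have "(\<Sum>s=1..n. w s) = (\<Sum>s=1..n. (1 + x ^ ?m) * t s + (g (s - 1) - g s))"
    using w_less by (rule sum.cong[OF refl])
  then have S: "(\<Sum>s=1..n. w s) = (1 + x ^ ?m) * (\<Sum>s=1..n. t s) + (g 0 - g n)"
    unfolding sum.distrib telescope sum_distrib_left .
  \<comment> \<open>The two ends of the telescope: \<open>2 * g 0\<close> makes up the gap between
    \<open>(1 - x ^ ?m) * A 0\<close> and \<open>(1 + x ^ ?m) * A 0\<close>, while
    \<open>w ?m - g n\<close> is the new theta term times the new product.\<close>
  have g0: "g 0 = x ^ ?m * A 0" and gn: "g n = (-1) ^ n * x ^ (?m * ?m) * B n"
    by (simp_all add: g_def A_def B_def)
  define \<theta> where "\<theta> = (\<Sum>j=1..n. (-1) ^ j * x ^ (j ^ 2))"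
  define y where "y = x ^ ?m"
  define z where "z = (-1) ^ n * x ^ (?m * ?m)"
  define T where "T = (\<Sum>s=1..n. t s)"
  have IH': "(1 + 2 * \<theta>) * B n = A 0 + 2 * T"
    using IH unfolding \<theta>_def T_def .
  have "(1 + 2 * (\<theta> - z)) * (B n * (1 + y)) = (1 + y) * ((1 + 2 * \<theta>) * B n) - 2 * (z * B n) * (1 + y)"
    by (simp add: algebra_simps)
  also have "\<dots> = A 0 * (1 - y) + 2 * ((1 + y) * T + (y * A 0 - z * B n) + - z * y * B n)"
    unfolding IH' by (simp add: algebra_simps)
  finally have "(1 + 2 * (\<theta> - z)) * (B n * (1 + y))
      = A 0 * (1 - y) + 2 * ((1 + y) * T + (y * A 0 - z * B n) + - z * y * B n)" .
  moreover have "(\<Prod>k=1..?m. 1 - x ^ k) = A 0 * (1 - y)"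
    using A0 by (simp add: y_def)
  moreover have "(\<Prod>k=1..?m. 1 + x ^ k) = B n * (1 + y)"
    using Bn by (simp add: y_def)
  moreover have "(\<Sum>j=1..?m. (-1) ^ j * x ^ (j ^ 2)) = \<theta> - z"
    by (simp add: \<theta>_def z_def power2_eq_square)
  moreover have "(\<Sum>s=1..?m. w s) = (1 + y) * T + (y * A 0 - z * B n) + - z * y * B n"
  proof -
    have "(\<Sum>s=1..?m. w s) = (\<Sum>s=1..n. w s) + w ?m" by simp
    then show ?thesis unfolding S w_last g0 gn by (simp add: y_def z_def T_def)
  qed
  ultimately show ?case
    unfolding w_def by (simp only:)
qed

text \<open>Every summand of the correction in \<open>gauss_theta_finite\<close> contains
  \<open>x ^ (s * (n + 1))\<close> with \<open>s\<close> at least 1, so it vanishes modulo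
  \<open>fps_X ^ (n + 1)\<close>.\<close>

lemma gauss_theta_upto:
  fixes M n :: nat
  assumes "M \<le> n + 1"
  shows "fps_eq_upto M ((1 + 2 * (\<Sum>j=1..n. (-1) ^ j * fps_X ^ (j ^ 2))) * (\<Prod>k=1..n. 1 + fps_X ^ k))
           (\<Prod>k=1..n. 1 - fps_X ^ k :: int fps)"
proof -
  have "fps_eq_upto M (2 * (\<Sum>s=1..n. (-1) ^ s * fps_X ^ (s * (n + 1)) * (\<Prod>k\<in>{s<..n}. 1 - fps_X ^ k)
                          * (\<Prod>k\<in>{1..<s}. 1 + fps_X ^ k :: int fps))) (\<Sum>s=1..n. 0)"
    unfolding sum_distrib_left
  proof (rule fps_eq_upto_sum)
    fix s assume "s \<in> {1..n}"
    then have "M \<le> s * (n + 1)"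
      using assms by (metis atLeastAtMost_iff mult.left_neutral mult_le_mono1 order_trans)
    then have "fps_eq_upto M (fps_X ^ (s * (n + 1)) * (2 * (-1) ^ s * (\<Prod>k\<in>{s<..n}. 1 - fps_X ^ k)
                          * (\<Prod>k\<in>{1..<s}. 1 + fps_X ^ k :: int fps))) 0"
      by (rule fps_eq_upto_X_power_mult)
    then show "fps_eq_upto M (2 * ((-1) ^ s * fps_X ^ (s * (n + 1)) * (\<Prod>k\<in>{s<..n}. 1 - fps_X ^ k)
                          * (\<Prod>k\<in>{1..<s}. 1 + fps_X ^ k :: int fps))) 0"
      by (simp only: mult_ac)
  qed
  then show ?thesis
    unfolding gauss_theta_finite by (simp add: fps_eq_upto_def)
qed

subsection \<open>Signed generating functions of partitions\<close>

definition signed_gf :: "nat list set \<Rightarrow> int fps" where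
  "signed_gf S = Abs_fps (\<lambda>N. \<Sum>\<pi> | \<pi> \<in> S \<and> sum_list \<pi> = N. (-1) ^ length \<pi>)"

text \<open>For \<open>m = 2 * s + 1\<close> the signed generating function is the product P_s. That
  product is never formed: only its recurrence in s and its agreement with 1 in low degrees are
  used.\<close>

definition parts_from :: "nat \<Rightarrow> nat list set" where
  "parts_from m = {\<pi>. is_partition \<pi> \<and> (\<forall>p\<in>set \<pi>. m \<le> p) \<and> (\<forall>p. even p \<longrightarrow> count_list \<pi> p \<le> 1)}"

definition least_part :: "nat \<Rightarrow> nat list set" where
  "least_part m = {\<pi> \<in> parts_from m. m \<in> set \<pi>}"

lemma finite_is_partition: "finite {\<pi>. is_partition \<pi> \<and> sum_list \<pi> = N}"
proof (rule finite_subset)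
  have len: "length xs \<le> sum_list xs" if "\<forall>p\<in>set xs. 0 < p" for xs :: "nat list"
    using that by (induction xs) auto
  show "{\<pi>. is_partition \<pi> \<and> sum_list \<pi> = N} \<subseteq> {xs. set xs \<subseteq> {..N} \<and> length xs \<le> N}"
    using len member_le_sum_list by (fastforce simp: is_partition_def)
  show "finite {xs. set xs \<subseteq> {..N} \<and> length xs \<le> N}"
    by (rule finite_lists_length_le) simp
qed

lemma finite_parts_from: "finite {\<pi>. \<pi> \<in> parts_from m \<and> sum_list \<pi> = N}"
  by (rule finite_subset[OF _ finite_is_partition[of N]]) (auto simp: parts_from_def)

text \<open>Parts are listed in decreasing order, so a smallest part stands at the end. An even
  \<open>m\<close> must not occur again, which leaves parts above \<open>m\<close>; an odd
  \<open>m\<close> may be repeated.\<close>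

lemma snoc_parts_from:
  assumes "0 < m"
  shows "\<pi> @ [m] \<in> parts_from m \<longleftrightarrow> \<pi> \<in> parts_from (if even m then Suc m else m)"
proof (cases "even m")
  case True
  have "m \<notin> set \<pi> \<and> (\<forall>p\<in>set \<pi>. m \<le> p) \<longleftrightarrow> (\<forall>p\<in>set \<pi>. Suc m \<le> p)"
    by (metis Suc_leD Suc_leI le_neq_implies_less not_less_eq_eq order_refl)
  moreover have "count_list \<pi> m + 1 \<le> 1 \<longleftrightarrow> m \<notin> set \<pi>"
    by (simp add: count_list_0_iff)
  moreover have "count_list (\<pi> @ [m]) p = count_list \<pi> p + of_bool (p = m)" for p
    by simp
  ultimately show ?thesis
    using True assms unfolding parts_from_def is_partition_def
    by (auto simp: sorted_wrt_append split: if_splits)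
next
  case False
  moreover have "count_list (\<pi> @ [m]) p = count_list \<pi> p" if "even p" for p
    using that False by auto
  ultimately show ?thesis
    using assms unfolding parts_from_def is_partition_def
    by (auto simp: sorted_wrt_append)
qed

lemma least_part_eq:
  assumes "0 < m"
  shows "least_part m = (\<lambda>\<pi>. \<pi> @ [m]) ` parts_from (if even m then Suc m else m)"
proof (intro equalityI subsetI)
  fix \<pi> assume \<pi>: "\<pi> \<in> least_part m"
  then have "\<pi> \<noteq> []" by (auto simp: least_part_def)
  then obtain \<sigma> k where \<sigma>: "\<pi> = \<sigma> @ [k]" by (metis rev_exhaust)
  have "k = m"
    using \<pi> unfolding \<sigma> by (auto simp: least_part_def parts_from_def is_partition_def sorted_wrt_append intro: antisym)
  then show "\<pi> \<in> (\<lambda>\<pi>. \<pi> @ [m]) ` parts_from (if even m then Suc m else m)"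
    using \<pi> snoc_parts_from[OF assms] unfolding \<sigma> least_part_def by blast
next
  fix \<pi> assume "\<pi> \<in> (\<lambda>\<pi>. \<pi> @ [m]) ` parts_from (if even m then Suc m else m)"
  then show "\<pi> \<in> least_part m"
    using snoc_parts_from[OF assms] by (auto simp: least_part_def)
qed

text \<open>Appending \<open>m\<close> raises the size by \<open>m\<close> and flips the sign, hence
  the factor \<open>- (fps_X ^ m)\<close>.\<close>

lemma signed_gf_least_part:
  assumes "0 < m"
  shows "signed_gf (least_part m) = - (fps_X ^ m * signed_gf (parts_from (if even m then Suc m else m)))"
proof (rule fps_ext)
  fix N
  let ?D = "parts_from (if even m then Suc m else m)"
  have eq: "{\<pi>. \<pi> \<in> least_part m \<and> sum_list \<pi> = N}
      = (\<lambda>\<pi>. \<pi> @ [m]) ` {\<pi>. \<pi> \<in> ?D \<and> sum_list \<pi> + m = N}"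
    unfolding least_part_eq[OF assms] by auto
  have "signed_gf (least_part m) $ N = - (\<Sum>\<pi> | \<pi> \<in> ?D \<and> sum_list \<pi> + m = N. (-1) ^ length \<pi>)"
    unfolding signed_gf_def fps_nth_Abs_fps eq by (subst sum.reindex) (auto simp: inj_on_def sum_negf)
  also have "{\<pi>. \<pi> \<in> ?D \<and> sum_list \<pi> + m = N}
      = (if m \<le> N then {\<pi>. \<pi> \<in> ?D \<and> sum_list \<pi> = N - m} else {})"
    by auto
  also have "- (\<Sum>\<pi> \<in> (if m \<le> N then {\<pi>. \<pi> \<in> ?D \<and> sum_list \<pi> = N - m} else {}). (-1) ^ length \<pi>)
      = (- (fps_X ^ m * signed_gf ?D)) $ N"
    by (simp add: signed_gf_def fps_X_power_mult_nth)
  finally show "signed_gf (least_part m) $ N = (- (fps_X ^ m * signed_gf ?D)) $ N" .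
qed

lemma signed_gf_parts_from:
  "signed_gf (parts_from m) = signed_gf (parts_from (Suc m)) + signed_gf (least_part m)"
proof (rule fps_ext)
  fix N
  have eq: "{\<pi>. \<pi> \<in> parts_from m \<and> sum_list \<pi> = N}
      = {\<pi>. \<pi> \<in> parts_from (Suc m) \<and> sum_list \<pi> = N} \<union> {\<pi>. \<pi> \<in> least_part m \<and> sum_list \<pi> = N}"
    by (auto simp: parts_from_def least_part_def Suc_le_eq less_le)
  have "finite {\<pi>. \<pi> \<in> least_part m \<and> sum_list \<pi> = N}"
    by (rule finite_subset[OF _ finite_parts_from[of m N]]) (auto simp: least_part_def)
  moreover have "{\<pi>. \<pi> \<in> parts_from (Suc m) \<and> sum_list \<pi> = N} \<inter> {\<pi>. \<pi> \<in> least_part m \<and> sum_list \<pi> = N} = {}"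
    by (auto simp: parts_from_def least_part_def)
  ultimately show "signed_gf (parts_from m) $ N
      = (signed_gf (parts_from (Suc m)) + signed_gf (least_part m)) $ N"
    by (simp add: signed_gf_def eq sum.union_disjoint finite_parts_from)
qed

text \<open>Below size \<open>m\<close> only the empty partition is left. This is how the infinite
  tail of P_s gets replaced by 1.\<close>

lemma signed_gf_parts_from_upto: "fps_eq_upto m (signed_gf (parts_from m)) 1"
  unfolding fps_eq_upto_def
proof (intro allI impI)
  fix N assume N: "N < m"
  have "{\<pi>. \<pi> \<in> parts_from m \<and> sum_list \<pi> = N} = (if N = 0 then {[]} else {})"
  proof -
    have "\<pi> = []" if "\<pi> \<in> parts_from m" "sum_list \<pi> < m" for \<pi>
      using that by (cases \<pi>) (auto simp: parts_from_def)
    moreover have "[] \<in> parts_from m"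
      by (simp add: parts_from_def is_partition_def)
    ultimately have "\<pi> \<in> parts_from m \<and> sum_list \<pi> = N \<longleftrightarrow> N = 0 \<and> \<pi> = []" for \<pi>
      using N by (metis sum_list.Nil)
    then show ?thesis by simp
  qed
  then show "signed_gf (parts_from m) $ N = 1 $ N"
    by (simp add: signed_gf_def)
qed

text \<open>Partitions are classified by their smallest part \<open>m\<close>; it is at most the
  size, so \<open>m \<le> N\<close> loses nothing.\<close>

lemma partitions4_nth:
  assumes "0 < r"
  shows "(\<Sum>\<pi> | \<pi> \<in> partitions4 r \<and> sum_list \<pi> = N. (-1) ^ length \<pi>)
       = (\<Sum>m | m \<le> N \<and> m mod 4 = r. signed_gf (least_part m) $ N)"
proof -
  let ?L = "\<lambda>m. {\<pi>. \<pi> \<in> least_part m \<and> sum_list \<pi> = N}"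
  have Min: "\<pi> \<in> least_part m \<longleftrightarrow> is_partition \<pi> \<and> \<pi> \<noteq> [] \<and>
     (\<forall>p. even p \<longrightarrow> count_list \<pi> p \<le> 1) \<and> Min (set \<pi>) = m" for \<pi> m
  proof (cases "\<pi> = []")
    case False
    then have "Min (set \<pi>) = m \<longleftrightarrow> m \<in> set \<pi> \<and> (\<forall>p\<in>set \<pi>. m \<le> p)"
      using Min_eq_iff[of "set \<pi>" m] by simp
    then show ?thesis using False by (auto simp: least_part_def parts_from_def)
  qed (simp add: least_part_def)
  have le: "Min (set \<pi>) \<le> sum_list \<pi>" if "\<pi> \<noteq> []" for \<pi> :: "nat list"
    using that by (simp add: member_le_sum_list)
  have eq: "{\<pi>. \<pi> \<in> partitions4 r \<and> sum_list \<pi> = N} = (\<Union>m\<in>{m. m \<le> N \<and> m mod 4 = r}. ?L m)"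
    using le by (auto simp: partitions4_def Min)
  have "finite (?L m)" for m
    by (rule finite_subset[OF _ finite_parts_from[of m N]]) (auto simp: least_part_def)
  then show ?thesis
    unfolding eq signed_gf_def fps_nth_Abs_fps
    by (intro sum.UNION_disjoint) (auto simp: Min)
qed

section \<open>The recurrence of P_s\<close>

lemma signed_gf_even_least:
  assumes "0 < s"
  shows "signed_gf (least_part (2 * s)) = - (fps_X ^ (2 * s) * signed_gf (parts_from (2 * s + 1)))"
  using signed_gf_least_part[of "2 * s"] assms by simp

lemma signed_gf_odd_least:
  "signed_gf (least_part (2 * s + 1)) = - (fps_X ^ (2 * s + 1) * signed_gf (parts_from (2 * s + 1)))"
  using signed_gf_least_part[of "2 * s + 1"] by simp

text \<open>Both sides equal the series for parts from \<open>2 * s + 2\<close> on. Splitting off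
  the repeatable part \<open>2 * s + 1\<close> gives the factor on the left, splitting off the
  unrepeatable part \<open>2 * s + 2\<close> the one on the right.\<close>

lemma signed_gf_step:
  "(1 + fps_X ^ (2 * s + 1)) * signed_gf (parts_from (2 * s + 1))
    = (1 - fps_X ^ (2 * s + 2)) * signed_gf (parts_from (2 * s + 3))"
proof -
  have "signed_gf (parts_from (2 * s + 2)) = signed_gf (parts_from (2 * s + 1)) - signed_gf (least_part (2 * s + 1))"
    using signed_gf_parts_from[of "2 * s + 1"] by simp
  also have "\<dots> = (1 + fps_X ^ (2 * s + 1)) * signed_gf (parts_from (2 * s + 1))"
    unfolding signed_gf_odd_least by (simp only: distrib_right diff_minus_eq_add mult_1_left)
  finally have "(1 + fps_X ^ (2 * s + 1)) * signed_gf (parts_from (2 * s + 1)) = signed_gf (parts_from (2 * s + 2))"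
    by simp
  also have "\<dots> = (1 - fps_X ^ (2 * s + 2)) * signed_gf (parts_from (2 * s + 3))"
    using signed_gf_parts_from[of "2 * s + 2"] signed_gf_even_least[of "Suc s"]
    by (simp add: numeral_3_eq_3 algebra_simps)
  finally show ?thesis .
qed

subsection \<open>The two generating series\<close>

text \<open>The partial sums of H(q^2) telescope: \<open>signed_gf_step\<close> rewrites the old
  right-hand side through the next P_s, and adding the next term turns it into the new right-hand
  side. That side is 1 in low degrees, hence H(q^2) = 1 / (1 + q).\<close>

lemma sum_signed_gf:
  "(1 + fps_X) * (\<Sum>s\<le>n. fps_X ^ (2 * s) * signed_gf (parts_from (2 * s + 1)))
    = (1 + fps_X ^ (2 * n + 1)) * signed_gf (parts_from (2 * n + 1))"
proof (induction n)
  case (Suc n)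
  let ?E = "signed_gf (parts_from (2 * n + 3))"
  have "(1 + fps_X) * (\<Sum>s\<le>Suc n. fps_X ^ (2 * s) * signed_gf (parts_from (2 * s + 1)))
      = (1 - fps_X ^ (2 * n + 2)) * ?E + (1 + fps_X) * (fps_X ^ (2 * n + 2) * ?E)"
    using Suc.IH signed_gf_step[of n] by (simp add: distrib_left numeral_3_eq_3)
  also have "\<dots> = (1 + fps_X ^ (2 * n + 3)) * ?E"
    by (simp add: algebra_simps power_Suc numeral_3_eq_3)
  finally show ?case by (simp add: numeral_3_eq_3)
qed simp

text \<open>The partial sum of H(z) at z = \<open>c\<close>. The argument is a power series because
  the functional equation is iterated along \<open>c\<close> = -q^2, -q^4, and so on.\<close>

definition gf_series :: "nat \<Rightarrow> int fps \<Rightarrow> int fps" where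
  "gf_series n c = (\<Sum>s\<le>n. c ^ s * signed_gf (parts_from (2 * s + 1)))"

text \<open>Multiplying \<open>signed_gf_step\<close> by \<open>c ^ (s + 1)\<close> and summing over
  all s would give (1 - c) H(c) = (1 + c q) H(c q^2); the subtracted term is what remains from
  stopping at \<open>n\<close>. The induction adds one such instance at a time.\<close>

lemma gf_series_functional_eq:
  "(1 - c) * gf_series n c = (1 + c * fps_X) * gf_series n (c * fps_X ^ 2)
     - c ^ (n + 1) * ((1 + fps_X ^ (2 * n + 1)) * signed_gf (parts_from (2 * n + 1)))"
proof (induction n)
  case 0
  show ?case by (simp add: gf_series_def algebra_simps)
next
  case (Suc n)
  let ?E = "signed_gf (parts_from (2 * n + 3))"
  define y :: "int fps" where "y = fps_X ^ (2 * n + 2)"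
  define d where "d = c ^ (n + 1)"
  define H H' F where "H = gf_series n c" and "H' = gf_series n (c * fps_X ^ 2)" and "F = ?E"
  have step: "(1 + fps_X ^ (2 * n + 1)) * signed_gf (parts_from (2 * n + 1)) = (1 - y) * ?E"
    using signed_gf_step[of n] by (simp add: y_def)
  have X: "fps_X ^ (2 * n + 3) = fps_X * y" "(c * fps_X ^ 2) ^ Suc n = d * y" "c ^ (Suc n + 1) = c * d"
    "c ^ Suc n = d"
  proof -
    show "(c * fps_X ^ 2) ^ Suc n = d * y"
      unfolding power_mult_distrib power_mult[symmetric] by (simp add: y_def d_def)
  qed (simp_all add: y_def d_def numeral_3_eq_3)
  have idx: "2 * Suc n + 1 = 2 * n + 3" by simp
  have S: "gf_series (Suc n) e = gf_series n e + e ^ Suc n * ?E" for e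
    by (simp add: gf_series_def numeral_3_eq_3)
  show ?case
    using Suc.IH unfolding S idx X step d_def[symmetric] H_def[symmetric] H'_def[symmetric] F_def[symmetric]
    by algebra
qed

text \<open>The functional equation is applied at -q^2, -q^4, ..., -q^(2k). Each truncation
  remainder contains \<open>c ^ (n + 1)\<close>, of order at least \<open>2 * n + 2\<close>, and so
  vanishes modulo \<open>fps_X ^ M\<close>.\<close>

lemma gf_series_iterate:
  assumes "M \<le> 2 * n + 2"
  shows "fps_eq_upto M ((\<Prod>j=1..k. 1 + fps_X ^ (2 * j)) * gf_series n (- (fps_X ^ 2)))
           ((\<Prod>j=1..k. 1 - fps_X ^ (2 * j + 1)) * gf_series n (- (fps_X ^ (2 * k + 2))))"
proof (induction k)
  case 0
  show ?case by (simp add: power2_eq_square)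
next
  case (Suc k)
  let ?P = "\<Prod>j=1..k. 1 + fps_X ^ (2 * j) :: int fps"
  let ?R = "\<Prod>j=1..k. 1 - fps_X ^ (2 * j + 1) :: int fps"
  let ?c = "- (fps_X ^ (2 * k + 2)) :: int fps"
  let ?E = "(1 + fps_X ^ (2 * n + 1)) * signed_gf (parts_from (2 * n + 1))"
  have "(2 * k + 2) * (n + 1) \<ge> M"
    using assms by (simp add: add_mult_distrib)
  then have "fps_eq_upto M (fps_X ^ ((2 * k + 2) * (n + 1)) * ((-1) ^ (n + 1) * ?E)) 0"
    by (rule fps_eq_upto_X_power_mult)
  moreover have "fps_X ^ ((2 * k + 2) * (n + 1)) * ((-1) ^ (n + 1) * ?E) = ?c ^ (n + 1) * ?E"
    unfolding power_minus[of "fps_X ^ (2 * k + 2)"] power_mult by (simp only: mult_ac)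
  ultimately have rem: "fps_eq_upto M (?c ^ (n + 1) * ?E) 0"
    by (simp only:)
  have c: "?c * fps_X ^ 2 = - (fps_X ^ (2 * Suc k + 2))" "1 + ?c * fps_X = 1 - fps_X ^ (2 * Suc k + 1)"
    "1 - ?c = 1 + fps_X ^ (2 * Suc k)"
    by (simp_all add: power2_eq_square mult_ac)
  have "(1 + fps_X ^ (2 * Suc k)) * gf_series n ?c
      = (1 - fps_X ^ (2 * Suc k + 1)) * gf_series n (- (fps_X ^ (2 * Suc k + 2))) - ?c ^ (n + 1) * ?E"
    using gf_series_functional_eq[of ?c n] unfolding c .
  then have step: "fps_eq_upto M ((1 + fps_X ^ (2 * Suc k)) * gf_series n ?c)
      ((1 - fps_X ^ (2 * Suc k + 1)) * gf_series n (- (fps_X ^ (2 * Suc k + 2))))"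
    using rem by (simp add: fps_eq_upto_def)
  have "(\<Prod>j=1..Suc k. 1 + fps_X ^ (2 * j)) * gf_series n (- (fps_X ^ 2))
      = (1 + fps_X ^ (2 * Suc k)) * (?P * gf_series n (- (fps_X ^ 2)))"
    by (simp add: mult_ac)
  also have "fps_eq_upto M \<dots> ((1 + fps_X ^ (2 * Suc k)) * (?R * gf_series n ?c))"
    by (rule fps_eq_upto_mult[OF fps_eq_upto_refl Suc.IH])
  also have "(1 + fps_X ^ (2 * Suc k)) * (?R * gf_series n ?c)
      = ?R * ((1 + fps_X ^ (2 * Suc k)) * gf_series n ?c)"
    by (simp only: mult_ac)
  also have "fps_eq_upto M \<dots> (?R * ((1 - fps_X ^ (2 * Suc k + 1))
      * gf_series n (- (fps_X ^ (2 * Suc k + 2)))))"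
    by (rule fps_eq_upto_mult[OF fps_eq_upto_refl step])
  also have "\<dots> = (\<Prod>j=1..Suc k. 1 - fps_X ^ (2 * j + 1)) * gf_series n (- (fps_X ^ (2 * Suc k + 2)))"
    by (simp add: mult_ac)
  finally show ?case .
qed

text \<open>All terms but the one for \<open>s = 0\<close> contain \<open>fps_X ^ k\<close>. This
  evaluates the end point of the iteration.\<close>

lemma gf_series_at_high_power:
  assumes "M \<le> k"
  shows "fps_eq_upto M (gf_series n (- (fps_X ^ k))) (signed_gf (parts_from 1))"
proof -
  have "fps_eq_upto M ((- (fps_X ^ k)) ^ s * signed_gf (parts_from (2 * s + 1)))
      (if s = 0 then signed_gf (parts_from 1) else 0)" for s
  proof (cases s)
    case (Suc r)
    have "(- (fps_X ^ k)) ^ s * signed_gf (parts_from (2 * s + 1))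
        = fps_X ^ k * (- ((- (fps_X ^ k)) ^ r * signed_gf (parts_from (2 * s + 1))))"
      by (simp add: Suc mult_ac)
    then have "fps_eq_upto M ((- (fps_X ^ k)) ^ s * signed_gf (parts_from (2 * s + 1))) 0"
      using fps_eq_upto_X_power_mult[OF assms] by metis
    then show ?thesis by (simp add: Suc)
  qed simp
  then have "fps_eq_upto M (gf_series n (- (fps_X ^ k)))
      (\<Sum>s\<le>n. if s = 0 then signed_gf (parts_from 1) else 0)"
    unfolding gf_series_def by (intro fps_eq_upto_sum)
  then show ?thesis by simp
qed

text \<open>The product formula of P_0 with denominators cleared, obtained from \<open>k\<close>
  uses of the recurrence.\<close>

lemma signed_gf_all_parts:
  "(\<Prod>j=1..k. 1 + fps_X ^ (2 * j - 1)) * signed_gf (parts_from 1)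
    = (\<Prod>j=1..k. 1 - fps_X ^ (2 * j)) * signed_gf (parts_from (2 * k + 1))"
proof (induction k)
  case (Suc k)
  have "(\<Prod>j=1..Suc k. 1 + fps_X ^ (2 * j - 1)) * signed_gf (parts_from 1)
     = (\<Prod>j=1..k. 1 - fps_X ^ (2 * j)) * ((1 + fps_X ^ (2 * k + 1)) * signed_gf (parts_from (2 * k + 1)))"
    using Suc.IH by (simp add: mult_ac)
  also have "\<dots> = (\<Prod>j=1..Suc k. 1 - fps_X ^ (2 * j)) * signed_gf (parts_from (2 * Suc k + 1))"
    unfolding signed_gf_step by (simp add: mult_ac numeral_3_eq_3)
  finally show ?case .
qed simp

section \<open>The value of H at -q^2 as a theta series\<close>

lemma prod_split_parity:
  fixes f :: "nat \<Rightarrow> 'a::comm_monoid_mult"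
  shows "prod f {1..2 * k} = (\<Prod>j=1..k. f (2 * j - 1)) * (\<Prod>j=1..k. f (2 * j))"
  by (induction k) (simp_all add: mult_ac)

lemma prod_nth_0:
  fixes f :: "'b \<Rightarrow> 'a::comm_ring_1 fps"
  assumes "\<And>k. k \<in> S \<Longrightarrow> f k $ 0 = 1"
  shows "prod f S $ 0 = 1"
  using assms by (induction S rule: infinite_finite_induct) auto

text \<open>Both sides are multiplied by the product \<open>?U\<close> of all
  \<open>1 + fps_X ^ j\<close>: its even factors clear the denominators of the iteration, its odd
  factors those of P_0. What results on the left is \<open>?V\<close>, as in Gauss's identity, and
  \<open>?U\<close> is cancelled. Taking \<open>k\<close> both as truncation and as number of
  iterations makes every error vanish modulo \<open>fps_X ^ (2 * k + 1)\<close>.\<close>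

lemma gf_series_theta:
  "fps_eq_upto (2 * k + 1) ((1 - fps_X) * gf_series k (- (fps_X ^ 2)))
     (1 + 2 * (\<Sum>j=1..2 * k. (-1) ^ j * fps_X ^ (j ^ 2)))"
proof -
  let ?M = "2 * k + 1"
  let ?G = "gf_series k (- (fps_X ^ 2))"
  let ?U = "\<Prod>j=1..2 * k. 1 + fps_X ^ j :: int fps"
  let ?odd = "\<Prod>j=1..k. 1 + fps_X ^ (2 * j - 1) :: int fps"
  let ?even = "\<Prod>j=1..k. 1 - fps_X ^ (2 * j) :: int fps"
  let ?R = "\<Prod>j=1..k. 1 - fps_X ^ (2 * j + 1) :: int fps"
  let ?V = "\<Prod>j=1..2 * k. 1 - fps_X ^ j :: int fps"
  have "fps_eq_upto ?M ((\<Prod>j=1..k. 1 + fps_X ^ (2 * j)) * ?G)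
      (?R * gf_series k (- (fps_X ^ (2 * k + 2))))"
    by (rule gf_series_iterate) simp
  also have "fps_eq_upto ?M \<dots> (?R * signed_gf (parts_from 1))"
    by (intro fps_eq_upto_mult fps_eq_upto_refl gf_series_at_high_power) simp
  finally have *: "fps_eq_upto ?M ((\<Prod>j=1..k. 1 + fps_X ^ (2 * j)) * ?G)
      (?R * signed_gf (parts_from 1))" .
  have "?U * ((1 - fps_X) * ?G)
      = (1 - fps_X) * ?odd * ((\<Prod>j=1..k. 1 + fps_X ^ (2 * j)) * ?G)"
    unfolding prod_split_parity by (simp only: mult_ac)
  also have "fps_eq_upto ?M \<dots> ((1 - fps_X) * ?odd * (?R * signed_gf (parts_from 1)))"
    by (intro fps_eq_upto_mult fps_eq_upto_refl *)
  also have "\<dots> = ((1 - fps_X) * ?R) * (?odd * signed_gf (parts_from 1))"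
    by (simp only: mult_ac)
  also have "\<dots> = ((1 - fps_X) * ?R) * (?even * signed_gf (parts_from ?M))"
    by (simp only: signed_gf_all_parts)
  \<comment> \<open>The exponents in \<open>?R\<close> run from 3 to \<open>2 * k + 1\<close>. The
    factor \<open>1 - fps_X\<close> supplies the missing exponent 1, and the surplus factor
    \<open>1 - fps_X ^ ?M\<close> is 1 modulo \<open>fps_X ^ ?M\<close>.\<close>
  also have "(1 - fps_X) * ?R = (1 - fps_X ^ ?M) * (\<Prod>j=1..k. 1 - fps_X ^ (2 * j - 1) :: int fps)"
    by (induction k) (simp_all add: mult_ac)
  also have "\<dots> * (?even * signed_gf (parts_from ?M)) = (1 - fps_X ^ ?M) * (?V * signed_gf (parts_from ?M))"
    unfolding prod_split_parity by (simp only: mult_ac)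
  also have "fps_eq_upto ?M \<dots> (1 * (?V * 1))"
    by (intro fps_eq_upto_mult fps_eq_upto_refl signed_gf_parts_from_upto one_minus_X_power_upto)
  also have "1 * (?V * 1) = ?V" by simp
  also have "fps_eq_upto ?M \<dots> ((1 + 2 * (\<Sum>j=1..2 * k. (-1) ^ j * fps_X ^ (j ^ 2))) * ?U)"
    by (intro fps_eq_upto_sym[OF gauss_theta_upto]) simp
  finally have "fps_eq_upto ?M (?U * ((1 - fps_X) * ?G))
      (?U * (1 + 2 * (\<Sum>j=1..2 * k. (-1) ^ j * fps_X ^ (j ^ 2))))"
    by (simp only: mult_ac)
  then show ?thesis
    by (rule fps_eq_upto_mult_cancel[rotated]) (auto intro: prod_nth_0)
qed

section \<open>The coefficient at N of the terms with odd index\<close>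

lemma odd_terms_nth:
  assumes "N > 0"
  shows "((1 - fps_X) * (\<Sum>s | s \<le> N \<and> odd s. fps_X ^ (2 * s) * signed_gf (parts_from (2 * s + 1)))) $ N
    = (-1) ^ N * of_bool (\<not> is_square N)"
proof -
  let ?E = "\<lambda>s. signed_gf (parts_from (2 * s + 1))"
  let ?D = "\<Sum>s | s \<le> N \<and> odd s. fps_X ^ (2 * s) * ?E s"
  let ?M = "2 * N + 1"
  let ?T = "\<Sum>j=1..2 * N. (-1) ^ j * fps_X ^ (j ^ 2) :: int fps"
  \<comment> \<open>The series 1 / (1 + q), the value of H(q^2).\<close>
  define g :: "int fps" where "g = Abs_fps (\<lambda>n. (-1) ^ n)"
  have g: "(1 + fps_X) * g = 1"
  proof (rule fps_ext)
    fix n show "((1 + fps_X) * g) $ n = 1 $ n"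
      by (cases n) (simp_all add: g_def distrib_right)
  qed
  have "fps_eq_upto ?M ((1 + fps_X) * (\<Sum>s\<le>N. fps_X ^ (2 * s) * ?E s)) (1 * 1)"
    unfolding sum_signed_gf
    by (intro fps_eq_upto_mult signed_gf_parts_from_upto one_plus_X_power_upto)
  then have "fps_eq_upto ?M ((1 + fps_X) * (\<Sum>s\<le>N. fps_X ^ (2 * s) * ?E s)) ((1 + fps_X) * g)"
    by (simp add: g)
  then have plus: "fps_eq_upto ?M (\<Sum>s\<le>N. fps_X ^ (2 * s) * ?E s) g"
    by (rule fps_eq_upto_mult_cancel[rotated]) simp
  \<comment> \<open>Subtracting H(-q^2) from H(q^2) doubles the odd terms and cancels the even ones.
    Keeping the factor 2 in front stays within integer coefficients; it is cancelled in a single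
    coefficient at the end.\<close>
  have D: "2 * ?D = (\<Sum>s\<le>N. fps_X ^ (2 * s) * ?E s) - gf_series N (- (fps_X ^ 2))"
  proof -
    have odd: "{s. s \<le> N \<and> odd s} = {s \<in> {..N}. odd s}" by auto
    have "?D = (\<Sum>s\<le>N. if odd s then fps_X ^ (2 * s) * ?E s else 0)"
      unfolding odd by (rule sum.inter_filter) simp
    moreover have "2 * (if odd s then fps_X ^ (2 * s) * ?E s else 0)
        = fps_X ^ (2 * s) * ?E s - (- (fps_X ^ 2)) ^ s * ?E s" for s
    proof -
      have "(- (fps_X ^ 2)) ^ s = (-1) ^ s * (fps_X ^ (2 * s) :: int fps)"
        by (simp only: power_minus[of "fps_X ^ 2"] power_mult)
      then show ?thesis by (cases "even s") simp_all
    qed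
    ultimately show ?thesis
      by (simp only: gf_series_def sum_subtractf[symmetric] sum_distrib_left)
  qed
  have "2 * ((1 - fps_X) * ?D) = (1 - fps_X) * (\<Sum>s\<le>N. fps_X ^ (2 * s) * ?E s)
      - (1 - fps_X) * gf_series N (- (fps_X ^ 2))"
    unfolding mult.left_commute[of 2] D right_diff_distrib ..
  also have "fps_eq_upto ?M \<dots> ((1 - fps_X) * g - (1 + 2 * ?T))"
    by (intro fps_eq_upto_diff fps_eq_upto_mult fps_eq_upto_refl plus gf_series_theta)
  \<comment> \<open>Here 1 - q = 2 - (1 + q), and \<open>g\<close> inverts 1 + q.\<close>
  also have "(1 - fps_X) * g = 2 * g - 1"
    using arg_cong[OF g, of "\<lambda>f. 2 * g - f"] by (simp add: algebra_simps)
  also have "2 * g - 1 - (1 + 2 * ?T) = 2 * (g - 1 - ?T)"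
    by (simp add: right_diff_distrib)
  finally have "fps_eq_upto ?M (2 * ((1 - fps_X) * ?D)) (2 * (g - 1 - ?T))" .
  then have "(2 * ((1 - fps_X) * ?D)) $ N = (2 * (g - 1 - ?T)) $ N"
    by (simp add: fps_eq_upto_def)
  then have "((1 - fps_X) * ?D) $ N = (g - 1 - ?T) $ N"
    unfolding numeral_fps_const fps_mult_left_const_nth by simp
  also have "\<dots> = (-1) ^ N - ?T $ N"
    using assms by (simp add: g_def)
  also have "?T $ N = (-1) ^ N * of_bool (is_square N)"
  proof -
    \<comment> \<open>Since \<open>j\<close> and \<open>j ^ 2\<close> have the same parity, the sign
      \<open>(-1) ^ j\<close> is \<open>(-1) ^ N\<close> whenever \<open>N = j ^ 2\<close>.\<close>
    have "?T $ N = (\<Sum>j=1..2 * N. (-1) ^ N * of_bool (N = j ^ 2))"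
      unfolding fps_sum_nth
    proof (rule sum.cong)
      fix j
      have "((-1) ^ j * fps_X ^ (j ^ 2) :: int fps) = fps_const ((-1) ^ j) * fps_X ^ (j ^ 2)"
        by (simp flip: fps_const_power fps_const_neg)
      then show "((-1) ^ j * fps_X ^ (j ^ 2) :: int fps) $ N = (-1) ^ N * of_bool (N = j ^ 2)"
        by (auto simp: minus_one_power_iff)
    qed simp
    also have "\<dots> = (-1) ^ N * (\<Sum>j\<in>{1..2 * N}. of_bool (N = j ^ 2))"
      by (simp only: sum_distrib_left)
    also have "(\<Sum>j\<in>{1..2 * N}. of_bool (N = j ^ 2)) = (of_bool (is_square N) :: int)"
    proof (cases "is_square N")
      case True
      then obtain r where r: "N = r ^ 2" by (auto elim: is_nth_powerE)
      have "r \<le> N" using r by (simp add: power2_eq_square)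
      \<comment> \<open>The summation range starts at 1; positivity of \<open>N\<close> rules out
        \<open>r = 0\<close>.\<close>
      then have "r \<in> {1..2 * N}" using r assms by (cases r) auto
      moreover have "N = j ^ 2 \<longleftrightarrow> j = r" for j
        using r by auto
      ultimately show ?thesis using True by (simp add: of_bool_def)
    next
      case False
      then have "N \<noteq> j ^ 2" for j by auto
      then show ?thesis using False by simp
    qed
    finally show ?thesis .
  qed
  finally show ?thesis by (simp add: of_bool_def)
qed

text \<open>Numbers congruent to 2 or 3 modulo 4 are \<open>2 * s\<close> or
  \<open>2 * s + 1\<close> with \<open>s\<close> odd. Letting \<open>s\<close> run up to
  \<open>N\<close> gives both residues the same index set; the surplus indices, collected in
  \<open>T'\<close>, have arguments beyond \<open>N\<close>, where \<open>f\<close>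
  vanishes.\<close>

lemma sum_residue_reindex:
  fixes f :: "nat \<Rightarrow> 'a::comm_monoid_add"
  assumes "r = 2 \<or> r = 3" and "\<And>m. N < m \<Longrightarrow> f m = 0"
  shows "(\<Sum>m | m \<le> N \<and> m mod 4 = r. f m) = (\<Sum>s | s \<le> N \<and> odd s. f (2 * s + (r - 2)))"
proof (rule sum.reindex_bij_witness_not_neutral[where i = "\<lambda>s. 2 * s + (r - 2)" and j = "\<lambda>m. m div 2"
      and S' = "{}" and T' = "{s. s \<le> N \<and> odd s \<and> N < 2 * s + (r - 2)}"])
  fix s assume "s \<in> {s. s \<le> N \<and> odd s} - {s. s \<le> N \<and> odd s \<and> N < 2 * s + (r - 2)}"
  then have s: "odd s" "2 * s + (r - 2) \<le> N" by auto
  have "(2 * s + (r - 2)) mod 4 = r"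
    using s(1) assms(1) by presburger
  then show "2 * s + (r - 2) \<in> {m. m \<le> N \<and> m mod 4 = r} - {}"
    using s(2) by simp
  show "(2 * s + (r - 2)) div 2 = s"
    using assms(1) by auto
next
  fix m assume "m \<in> {m. m \<le> N \<and> m mod 4 = r} - {}"
  then have m: "m \<le> N" "m mod 4 = r" by auto
  show *: "2 * (m div 2) + (r - 2) = m"
    using m(2) assms(1) by presburger
  have "odd (m div 2)"
    using m(2) assms(1) by presburger
  then show "m div 2 \<in> {s. s \<le> N \<and> odd s} - {s. s \<le> N \<and> odd s \<and> N < 2 * s + (r - 2)}"
    using m(1) * by auto
next
  fix m assume "m \<in> {m. m \<le> N \<and> m mod 4 = r}"
  then have "2 * (m div 2) + (r - 2) = m"
    using assms(1) by simp presburger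
  then show "f (2 * (m div 2) + (r - 2)) = f m" by (simp only:)
qed (use assms in auto)

lemma signed_gf_least_part_nth_less:
  assumes "N < m"
  shows "signed_gf (least_part m) $ N = 0"
  using assms by (simp add: signed_gf_least_part fps_X_power_mult_nth)

theorem theorem5p7:
  fixes N :: nat
  assumes "N > 0"
  shows "(\<Sum>\<pi> | \<pi> \<in> partitions4 3 \<and> sum_list \<pi> = N. (-1 :: int) ^ length \<pi>)
       - (\<Sum>\<pi> | \<pi> \<in> partitions4 2 \<and> sum_list \<pi> = N. (-1 :: int) ^ length \<pi>)
       = (-1) ^ N * of_bool (\<not> is_square N)"
proof -
  let ?I = "{s. s \<le> N \<and> odd s}"
  let ?E = "\<lambda>s. signed_gf (parts_from (2 * s + 1))"
  have three: "(\<Sum>\<pi> | \<pi> \<in> partitions4 3 \<and> sum_list \<pi> = N. (-1 :: int) ^ length \<pi>)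
      = (\<Sum>s\<in>?I. (- (fps_X ^ (2 * s + 1) * ?E s)) $ N)"
    using sum_residue_reindex[of 3 N "\<lambda>m. signed_gf (least_part m) $ N"]
    by (simp add: partitions4_nth signed_gf_least_part_nth_less signed_gf_odd_least[simplified])
  have two: "(\<Sum>\<pi> | \<pi> \<in> partitions4 2 \<and> sum_list \<pi> = N. (-1 :: int) ^ length \<pi>)
      = (\<Sum>s\<in>?I. (- (fps_X ^ (2 * s) * ?E s)) $ N)"
  proof -
    have "(\<Sum>s\<in>?I. signed_gf (least_part (2 * s)) $ N) = (\<Sum>s\<in>?I. (- (fps_X ^ (2 * s) * ?E s)) $ N)"
      by (rule sum.cong) (simp_all add: signed_gf_even_least odd_pos)
    then show ?thesis
      using sum_residue_reindex[of 2 N "\<lambda>m. signed_gf (least_part m) $ N"]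
      by (simp add: partitions4_nth signed_gf_least_part_nth_less)
  qed
  \<comment> \<open>Removing a smallest part \<open>2 * s\<close> or \<open>2 * s + 1\<close> leaves
    the same family of partitions, so the two sums combine termwise with the factor 1 - q.\<close>
  have "(\<Sum>s\<in>?I. (- (fps_X ^ (2 * s + 1) * ?E s)) $ N) - (\<Sum>s\<in>?I. (- (fps_X ^ (2 * s) * ?E s)) $ N)
      = ((1 - fps_X) * (\<Sum>s\<in>?I. fps_X ^ (2 * s) * ?E s)) $ N"
    unfolding sum_subtractf[symmetric] sum_distrib_left fps_sum_nth
    by (rule sum.cong) (simp_all add: left_diff_distrib mult.assoc)
  then show ?thesis
    unfolding three two odd_terms_nth[OF assms] .
qed

end
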